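(* Let $N\ge2$ be an integer, $m,\varepsilon>0$, $E\in\mathbb{R}$, $V:\mathbb{R}\to\mathbb{R}$, and $x=(x_1,\dots,x_N)\in\mathbb{R}^N$, with $x_0=x_N$. Put $W=E/\varepsilon$, $\nu=\frac{N-2}{2}$, $$S_0=\frac{1}{N\varepsilon}\sum_{k=1}^N\frac m2\Big(\frac{x_{k-1}-x_k}{1/(N\varepsilon)}\Big)^2,\qquad S_1=\frac{1}{N\varepsilon}\sum_{k=1}^NV(x_k),$$ and $$K_N=\int_{\mathbb{R}^N}\frac{d^Np}{(2\pi)^N}\,\frac{e^{\mathrm{i}\sum_{k=1}^Np_k(x_{k-1}-x_k)}}{\sqrt{2\pi\varepsilon^2}}\exp\!\Big[-\frac12\Big(\frac{1}{2mN\varepsilon}\sum_{k=1}^Np_k^2+S_1-W\Big)^2\Big].$$ Then $$K_N=\Big(\frac{mN\varepsilon}{2\pi}\Big)^{N/2}\frac{1}{\sqrt{2\pi\varepsilon^2}}\int_0^\infty dr\,\Big(\frac{r}{S_0}\Big)^{\nu/2}J_\nu\big(2\sqrt{S_0r}\big)\exp\!\Big[-\frac12\big(r+S_1-W\big)^2\Big].$$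
   Context: $J_\nu$ is the Bessel function of the first kind. When $S_0=0$, the factor $(r/S_0)^{\nu/2}J_\nu(2\sqrt{S_0r})$ is understood through its power series $\sum_{n\ge0}\frac{(-S_0)^nr^{\nu+n}}{n!\,\Gamma(\nu+n+1)}$, i.e. as $r^\nu/\Gamma(\nu+1)$. *)

theory Defs
  imports "HOL-Analysis.Analysis"
begin

(* Bessel function of the first kind, by its power series, for real order nu and real z > 0
   (also z = 0 if nu >= 0).  The case split makes up for 0 powr 0 = 0, so that J_0(0) = 1.
   At a pole of Gamma the term is 0, because Gamma is 0 there and division by 0 gives 0. *)
definition bessel_J :: "real \<Rightarrow> real \<Rightarrow> real" where
  "bessel_J \<nu> z =
     (if \<nu> = 0 then 1 else (z / 2) powr \<nu>) *
     (\<Sum>n. (-1) ^ n / (fact n * Gamma (\<nu> + real n + 1)) * (z / 2) ^ (2 * n))"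

(* A closed path is x :: nat => real with x 0 = x N; only x 0, ..., x N matter. *)

definition S0 :: "nat \<Rightarrow> real \<Rightarrow> real \<Rightarrow> (nat \<Rightarrow> real) \<Rightarrow> real" where
  "S0 N m \<epsilon> x =
     1 / (real N * \<epsilon>) * (\<Sum>k=1..N. m / 2 * ((x (k - 1) - x k) / (1 / (real N * \<epsilon>)))\<^sup>2)"

definition S1 :: "nat \<Rightarrow> real \<Rightarrow> (real \<Rightarrow> real) \<Rightarrow> (nat \<Rightarrow> real) \<Rightarrow> real" where
  "S1 N \<epsilon> V x = 1 / (real N * \<epsilon>) * (\<Sum>k=1..N. V (x k))"

(* Lebesgue measure on R^N, with coordinates indexed by 1, ..., N *)
abbreviation momentum_space :: "nat \<Rightarrow> (nat \<Rightarrow> real) measure" where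
  "momentum_space N \<equiv> (\<Pi>\<^sub>M k\<in>{1..N}. lborel)"

definition K_integrand ::
  "nat \<Rightarrow> real \<Rightarrow> real \<Rightarrow> real \<Rightarrow> (real \<Rightarrow> real) \<Rightarrow> (nat \<Rightarrow> real) \<Rightarrow> (nat \<Rightarrow> real) \<Rightarrow> complex" where
  "K_integrand N m \<epsilon> E V x p =
     1 / (2 * complex_of_real pi) ^ N *
     (exp (\<i> * complex_of_real (\<Sum>k=1..N. p k * (x (k - 1) - x k)))
        / complex_of_real (sqrt (2 * pi * \<epsilon>\<^sup>2))) *
     complex_of_real
       (exp (- 1 / 2 * (1 / (2 * m * real N * \<epsilon>) * (\<Sum>k=1..N. (p k)\<^sup>2) + S1 N \<epsilon> V x - E / \<epsilon>)\<^sup>2))"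

definition K ::
  "nat \<Rightarrow> real \<Rightarrow> real \<Rightarrow> real \<Rightarrow> (real \<Rightarrow> real) \<Rightarrow> (nat \<Rightarrow> real) \<Rightarrow> complex" where
  "K N m \<epsilon> E V x = (LINT p|momentum_space N. K_integrand N m \<epsilon> E V x p)"

(* (r/s)^(nu/2) J_nu(2 sqrt(s r)) for r > 0 and s >= 0; at s = 0 it is the value of the series
   sum_n (-s)^n r^(nu+n) / (n! Gamma(nu+n+1)). *)
definition bessel_factor :: "real \<Rightarrow> real \<Rightarrow> real \<Rightarrow> real" where
  "bessel_factor \<nu> s r =
     (if s = 0 then r powr \<nu> / Gamma (\<nu> + 1)
      else (r / s) powr (\<nu> / 2) * bessel_J \<nu> (2 * sqrt (s * r)))"

definition radial_integrand ::
  "nat \<Rightarrow> real \<Rightarrow> real \<Rightarrow> real \<Rightarrow> (real \<Rightarrow> real) \<Rightarrow> (nat \<Rightarrow> real) \<Rightarrow> real \<Rightarrow> real" where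
  "radial_integrand N m \<epsilon> E V x r =
     bessel_factor ((real N - 2) / 2) (S0 N m \<epsilon> x) r *
     exp (- 1 / 2 * (r + S1 N \<epsilon> V x - E / \<epsilon>)\<^sup>2)"

end

theory Submission
  imports Defs "HOL-Probability.Distributions" "HOL-Complex_Analysis.Cauchy_Integral_Formula"
begin

text \<open>
  After expanding the exponential, everything reduces to the moments
  \<open>\<integral> (p \<bullet> y)^k f(a |p|^2) dp\<close>; the odd ones vanish by \<open>p \<mapsto> -p\<close>. For a weight \<open>h\<close> homogeneous of
  degree \<open>d\<close>, Tonelli's theorem and scaling give, with \<open>\<alpha> = (N + d) / 2\<close>,
  \<open>(\<integral> h(p) exp(-|p|^2) dp) (\<integral> r^(\<alpha>-1) f(r) dr) = a^\<alpha> \<Gamma>(\<alpha>) \<integral> h(p) f(a |p|^2) dp\<close>,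
  which replaces polar coordinates and reduces the moments for \<open>f\<close> to Gaussian ones. The latter are
  read off the Gaussian generating function \<open>\<integral> exp(t p \<bullet> y - |p|^2) dp\<close>. Resumming the resulting
  series under the radial integral produces the power series of the Bessel factor.
\<close>

section \<open>Scaling, reflection and null sets for Lebesgue measure on a finite power of the
  reals\<close>

interpretation momentum: product_sigma_finite "\<lambda>_::'i. lborel :: real measure"
  by standard

text \<open>A product measure is determined by its values on boxes, and there the one-dimensional
  affine change of variables applies on each axis; the density is the Jacobian. As an equation of
  measures it serves both the nonnegative and the Bochner integral.\<close>

lemma PiM_lborel_scale:
  fixes c :: real
  assumes I: "finite I" and c: "c \<noteq> 0"
  shows "density (distr (PiM I (\<lambda>_. lborel)) (PiM I (\<lambda>_. lborel)) (\<lambda>p. \<lambda>k\<in>I. c * p k))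
           (\<lambda>_. ennreal (\<bar>c\<bar> ^ card I)) = PiM I (\<lambda>_. lborel)"
proof (rule momentum.PiM_eqI[OF I])
  fix A :: "'a \<Rightarrow> real set"
  assume "\<And>i. i \<in> I \<Longrightarrow> A i \<in> sets lborel"
  then have A[measurable]: "\<And>i. i \<in> I \<Longrightarrow> A i \<in> sets borel"
    by simp
  let ?M = "PiM I (\<lambda>_. lborel) :: ('a \<Rightarrow> real) measure"
  let ?T = "\<lambda>p. \<lambda>k\<in>I. c * p k"
  have T[measurable]: "?T \<in> measurable ?M ?M"
    by measurable
  have box: "Pi\<^sub>E I A \<in> sets ?M"
    using I A by (intro sets_PiM_I_finite) auto
  have pre: "(\<lambda>t. c * t) -` A i \<in> sets borel" if "i \<in> I" for i
    using measurable_sets_borel[of "\<lambda>t. c * t" borel "A i"] A[OF that] by auto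
  have "?T -` Pi\<^sub>E I A \<inter> space ?M = Pi\<^sub>E I (\<lambda>i. (\<lambda>t. c * t) -` A i)"
    by (auto simp: space_PiM PiE_iff extensional_def)
  then have "emeasure (distr ?M ?M ?T) (Pi\<^sub>E I A) = (\<Prod>i\<in>I. emeasure lborel ((\<lambda>t. c * t) -` A i))"
    using box I pre by (simp add: emeasure_distr momentum.emeasure_PiM)
  moreover have "ennreal \<bar>c\<bar> * emeasure lborel ((\<lambda>t. c * t) -` A i) = emeasure lborel (A i)"
    if "i \<in> I" for i
    using A[OF that] c
    by (subst (2) lborel_real_affine[OF c, of 0]) (simp add: emeasure_density emeasure_distr nn_integral_cmult nn_integral_distr pre[OF that])
  then have "(\<Prod>i\<in>I. emeasure lborel (A i)) = (\<Prod>i\<in>I. ennreal \<bar>c\<bar> * emeasure lborel ((\<lambda>t. c * t) -` A i))"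
    by simp
  ultimately show "emeasure (density (distr ?M ?M ?T) (\<lambda>_. ennreal (\<bar>c\<bar> ^ card I))) (Pi\<^sub>E I A)
      = (\<Prod>i\<in>I. emeasure lborel (A i))"
    using box by (simp add: emeasure_density nn_integral_cmult prod.distrib prod_ennreal flip: ennreal_power)
qed simp

lemma nn_integral_PiM_scale:
  fixes c :: real
  assumes "finite I" and "c \<noteq> 0" and [measurable]: "g \<in> borel_measurable (PiM I (\<lambda>_. lborel))"
  shows "(\<integral>\<^sup>+p. g p \<partial>PiM I (\<lambda>_. lborel))
           = ennreal (\<bar>c\<bar> ^ card I) * (\<integral>\<^sup>+p. g (\<lambda>k\<in>I. c * p k) \<partial>PiM I (\<lambda>_. lborel))"
  by (subst PiM_lborel_scale[OF assms(1,2), symmetric])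
     (simp add: nn_integral_density nn_integral_distr nn_integral_cmult)

lemma integral_PiM_uminus:
  fixes g :: "('i \<Rightarrow> real) \<Rightarrow> real"
  assumes "finite I" and [measurable]: "g \<in> borel_measurable (PiM I (\<lambda>_. lborel))"
  shows "(\<integral>p. g p \<partial>PiM I (\<lambda>_. lborel)) = (\<integral>p. g (\<lambda>k\<in>I. - p k) \<partial>PiM I (\<lambda>_. lborel))"
  by (subst PiM_lborel_scale[OF assms(1), of "-1", symmetric])
     (simp_all add: density_1 integral_distr)

text \<open>Only the origin is excluded, a box with null sides. For empty \<open>I\<close> this
  would fail, since the empty product is a point of mass 1.\<close>

lemma AE_PiM_lborel_sum_squares_pos:
  assumes I: "finite I" "I \<noteq> {}"
  shows "AE p in PiM I (\<lambda>_. lborel). 0 < (\<Sum>k\<in>I. (p k :: real)\<^sup>2)"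
proof (rule AE_I')
  have "emeasure (PiM I (\<lambda>_. lborel :: real measure)) (Pi\<^sub>E I (\<lambda>_. {0})) = 0"
    using I by (subst momentum.emeasure_PiM) auto
  then show "Pi\<^sub>E I (\<lambda>_. {0 :: real}) \<in> null_sets (PiM I (\<lambda>_. lborel))"
    using I by (intro null_setsI sets_PiM_I_finite) auto
  show "{p \<in> space (PiM I (\<lambda>_. lborel)). \<not> 0 < (\<Sum>k\<in>I. (p k)\<^sup>2)} \<subseteq> Pi\<^sub>E I (\<lambda>_. {0 :: real})"
  proof
    fix p assume p: "p \<in> {p \<in> space (PiM I (\<lambda>_. lborel)). \<not> 0 < (\<Sum>k\<in>I. (p k :: real)\<^sup>2)}"
    then have "(\<Sum>k\<in>I. (p k)\<^sup>2) = 0"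
      using sum_nonneg[of I "\<lambda>k. (p k)\<^sup>2"] by auto
    then show "p \<in> Pi\<^sub>E I (\<lambda>_. {0})"
      using p I by (auto simp: sum_nonneg_eq_0_iff space_PiM PiE_iff extensional_def fun_eq_iff)
  qed
qed

section \<open>Gaussian and inverse-gamma integrals\<close>

text \<open>Completing the square gives a multiple of the normal density with mean
  \<open>b / 2\<close> and variance \<open>1 / 2\<close>.\<close>

lemma gaussian_exp_linear:
  "has_bochner_integral lborel (\<lambda>t::real. exp (b * t - t\<^sup>2)) (sqrt pi * exp (b\<^sup>2 / 4))"
proof -
  have "exp (b * t - t\<^sup>2) = sqrt pi * exp (b\<^sup>2 / 4) * normal_density (b / 2) (sqrt (1 / 2)) t" for t
    by (simp add: normal_density_def exp_add[symmetric] field_simps power2_eq_square)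
  then show ?thesis
    by (simp only: has_bochner_integral_iff) (auto simp del: real_sqrt_divide)
qed

text \<open>The integrand factorises over the coordinates. As a function of \<open>t\<close> this is
  the generating function of the Gaussian moments.\<close>

lemma gaussian_exp_PiM:
  fixes y :: "'i \<Rightarrow> real"
  assumes I: "finite I"
  shows "has_bochner_integral (PiM I (\<lambda>_. lborel))
           (\<lambda>p. exp (t * (\<Sum>k\<in>I. p k * y k)) * exp (- (\<Sum>k\<in>I. (p k)\<^sup>2)))
           (sqrt pi ^ card I * exp (t\<^sup>2 * (\<Sum>k\<in>I. (y k)\<^sup>2) / 4))"
proof -
  have e: "exp (t * (\<Sum>k\<in>I. p k * y k)) * exp (- (\<Sum>k\<in>I. (p k)\<^sup>2))
      = (\<Prod>k\<in>I. exp (t * y k * p k - (p k)\<^sup>2))" for p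
    using I by (simp add: exp_sum[symmetric] exp_add[symmetric] sum_subtractf sum_distrib_left mult_ac)
  have i: "integrable lborel (\<lambda>s::real. exp (t * y k * s - s\<^sup>2))"
      and v: "(\<integral>s. exp (t * y k * s - s\<^sup>2) \<partial>lborel) = sqrt pi * exp (t\<^sup>2 * (y k)\<^sup>2 / 4)" for k
    using gaussian_exp_linear[of "t * y k"] by (simp_all add: has_bochner_integral_iff power_mult_distrib)
  have "(\<Prod>k\<in>I. sqrt pi * exp (t\<^sup>2 * (y k)\<^sup>2 / 4)) = sqrt pi ^ card I * exp (t\<^sup>2 * (\<Sum>k\<in>I. (y k)\<^sup>2) / 4)"
    using I by (simp add: prod.distrib exp_sum[symmetric] sum_distrib_left sum_divide_distrib)
  then show ?thesis
    unfolding e has_bochner_integral_iff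
    using momentum.product_integrable_prod[OF I, of "\<lambda>k s. exp (t * y k * s - s\<^sup>2)"]
      momentum.product_integral_prod[OF I, of "\<lambda>k s. exp (t * y k * s - s\<^sup>2)"] i
    by (simp add: v)
qed

text \<open>The inversion \<open>t = x / s\<close> in the Gamma integral; up to normalisation the
  integrand is the inverse-gamma density. It serves to integrate out the auxiliary scale
  \<open>s\<close> in the radial identity.\<close>

lemma nn_integral_inverse_Gamma:
  fixes x \<alpha> :: real
  assumes x: "x > 0" and \<alpha>: "\<alpha> > 0"
  shows "(\<integral>\<^sup>+s. ennreal (indicator {0<..} s * (x powr \<alpha> * s powr (- \<alpha> - 1) * exp (- x / s))) \<partial>lborel)
           = ennreal (Gamma \<alpha>)"
proof -
  let ?f = "\<lambda>t. t powr (\<alpha> - 1) / exp t" and ?g = "\<lambda>s. x / s"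
  have im: "?g ` {0<..} = {0<..}"
  proof -
    have "t \<in> ?g ` {0<..}" if "t > 0" for t
      using x that by (intro image_eqI[of _ _ "x / t"]) auto
    then show ?thesis using x by auto
  qed
  \<comment> \<open>The negligible point 0 is dropped because \<open>s \<mapsto> x / s\<close> is a
    bijection of the open half-line only.\<close>
  have f: "(?f has_integral Gamma \<alpha>) {0<..}"
    using Gamma_integral_real[OF \<alpha>]
    by (rule has_integral_spike_set_eq[THEN iffD1, rotated -1]) (auto intro: negligible_subset[of "{0}"])
  then have "?f absolutely_integrable_on ?g ` {0<..} \<and> integral (?g ` {0<..}) ?f = Gamma \<alpha>"
    unfolding im by (auto simp: has_integral_iff intro!: nonnegative_absolutely_integrable_1)
  then have "(\<lambda>s. \<bar>- x / s\<^sup>2\<bar> * ?f (?g s)) absolutely_integrable_on {0<..} \<and>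
      integral {0<..} (\<lambda>s. \<bar>- x / s\<^sup>2\<bar> * ?f (?g s)) = Gamma \<alpha>"
    using x by (subst has_absolute_integral_change_of_variables_1')
      (auto intro!: derivative_eq_intros inj_onI simp: power2_eq_square field_simps)
  then have "((\<lambda>s. \<bar>- x / s\<^sup>2\<bar> * ?f (?g s)) has_integral Gamma \<alpha>) {0<..}"
    by (auto simp: has_integral_iff absolutely_integrable_on_def)
  then have "(\<integral>\<^sup>+s. ennreal (indicator {0<..} s * (\<bar>- x / s\<^sup>2\<bar> * ?f (?g s))) \<partial>lborel) = ennreal (Gamma \<alpha>)"
    by (intro nn_integral_has_integral_lebesgue) auto
  moreover have "\<bar>- x / s\<^sup>2\<bar> * ?f (?g s) = x powr \<alpha> * s powr (- \<alpha> - 1) * exp (- x / s)" if "s > 0" for s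
    using x that by (simp add: powr_divide powr_diff powr_minus exp_minus power2_eq_square field_simps powr_numeral)
  ultimately show ?thesis
    by (auto simp: indicator_def intro!: nn_integral_cong elim!: trans[rotated])
qed

section \<open>The radial identity replacing polar coordinates\<close>

text \<open>The left side is a double integral over \<open>p\<close> and a scale \<open>s\<close>,
  where \<open>r\<close> is \<open>a * s\<close> times the square of the length of \<open>p\<close>.
  Rescaling \<open>p\<close> for fixed \<open>s\<close> removes \<open>s\<close> from the argument
  of \<open>f\<close>; homogeneity turns the rest of the \<open>s\<close>-dependence into an
  inverse-gamma weight, whose integral is \<open>Gamma \<alpha>\<close>. In \<open>ennreal\<close>
  all exchanges are instances of Tonelli.\<close>

lemma nn_integral_homogeneous_radial:
  fixes h :: "('i \<Rightarrow> real) \<Rightarrow> real" and f :: "real \<Rightarrow> real" and a d :: real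
  assumes I: "finite I" "I \<noteq> {}" and a: "a > 0" and d: "d \<ge> 0"
    and [measurable]: "h \<in> borel_measurable (PiM I (\<lambda>_. lborel))" "f \<in> borel_measurable borel"
    and h: "\<And>p. h p \<ge> 0" and f: "\<And>r. f r \<ge> 0"
    and hom: "\<And>c p. c > 0 \<Longrightarrow> h (\<lambda>k\<in>I. c * p k) = c powr d * h p"
  defines "\<alpha> \<equiv> (real (card I) + d) / 2"
  shows "(\<integral>\<^sup>+p. ennreal (h p * exp (- (\<Sum>k\<in>I. (p k)\<^sup>2))) \<partial>PiM I (\<lambda>_. lborel))
           * (\<integral>\<^sup>+r. ennreal (indicator {0<..} r * (r powr (\<alpha> - 1) * f r)) \<partial>lborel)
         = ennreal (a powr \<alpha> * Gamma \<alpha>)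
           * (\<integral>\<^sup>+p. ennreal (h p * f (a * (\<Sum>k\<in>I. (p k)\<^sup>2))) \<partial>PiM I (\<lambda>_. lborel))"
proof -
  let ?M = "PiM I (\<lambda>_. lborel :: real measure)"
  define q where "q p = (\<Sum>k\<in>I. (p k)\<^sup>2)" for p :: "'i \<Rightarrow> real"
  define J where "J = (\<integral>\<^sup>+r. ennreal (indicator {0<..} r * (r powr (\<alpha> - 1) * f r)) \<partial>lborel)"
  have q[measurable]: "q \<in> borel_measurable ?M"
    unfolding q_def by measurable
  have \<alpha>: "\<alpha> > 0"
    using I d by (simp add: \<alpha>_def card_gt_0_iff add_pos_nonneg)
  have ae: "AE p in ?M. 0 < q p"
    unfolding q_def using I by (rule AE_PiM_lborel_sum_squares_pos)
  interpret sigma_finite_measure ?M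
    using momentum.sigma_finite[OF I(1)] .
  interpret pair_sigma_finite ?M "lborel :: real measure" ..
  let ?F = "\<lambda>p s. indicator {0<..} s * (h p * exp (- q p) * q p powr \<alpha> * s powr (\<alpha> - 1) * f (a * (s * q p)))"
  let ?G = "\<lambda>p s. indicator {0<..} s * (h p * exp (- q p / s) * q p powr \<alpha> * s powr (- \<alpha> - 1) * f (a * q p))"
  \<comment> \<open>substitute \<open>r = a s |p|^2\<close> in the radial integral\<close>
  have 1: "ennreal (h p * exp (- q p)) * J = ennreal (a powr \<alpha>) * (\<integral>\<^sup>+s. ennreal (?F p s) \<partial>lborel)"
    if q: "q p > 0" for p
  proof -
    have "J = ennreal (a * q p) * (\<integral>\<^sup>+s. ennreal (indicator {0<..} (a * q p * s) *
        ((a * q p * s) powr (\<alpha> - 1) * f (a * q p * s))) \<partial>lborel)"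
      unfolding J_def using q a by (subst nn_integral_real_affine[of _ "a * q p" 0]) auto
    then have "ennreal (h p * exp (- q p)) * J = (\<integral>\<^sup>+s. ennreal (h p * exp (- q p) * (a * q p) * (indicator {0<..} (a * q p * s) *
        ((a * q p * s) powr (\<alpha> - 1) * f (a * q p * s)))) \<partial>lborel)"
      using h[of p] q a f by (simp add: nn_integral_cmult[symmetric] ennreal_mult[symmetric] mult_ac)
    also have "\<dots> = (\<integral>\<^sup>+s. ennreal (a powr \<alpha> * ?F p s) \<partial>lborel)"
    proof (intro nn_integral_cong arg_cong[where f = ennreal])
      fix s :: real
      show "h p * exp (- q p) * (a * q p) * (indicator {0<..} (a * q p * s) *
        ((a * q p * s) powr (\<alpha> - 1) * f (a * q p * s))) = a powr \<alpha> * ?F p s"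
        using q a by (cases "s > 0") (auto simp: powr_mult powr_diff zero_less_mult_iff mult_ac)
    qed
    also have "\<dots> = ennreal (a powr \<alpha>) * (\<integral>\<^sup>+s. ennreal (?F p s) \<partial>lborel)"
      using h f by (simp add: nn_integral_cmult[symmetric] ennreal_mult)
    finally show ?thesis .
  qed
  \<comment> \<open>scale \<open>p\<close> by \<open>s^(-1/2)\<close>, so that \<open>f\<close> no longer sees \<open>s\<close>\<close>
  have 2: "(\<integral>\<^sup>+p. ennreal (?F p s) \<partial>?M) = (\<integral>\<^sup>+p. ennreal (?G p s) \<partial>?M)" for s
  proof (cases "s > 0")
    case True
    define c where "c = 1 / sqrt s"
    have c: "c > 0" and c2: "c\<^sup>2 = 1 / s" and cs: "c = s powr (- 1 / 2)"
      using True by (auto simp: c_def power_divide powr_minus powr_half_sqrt field_simps)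
    have qc: "q (\<lambda>k\<in>I. c * p k) = q p / s" for p
      by (simp add: q_def power_mult_distrib c2 sum_divide_distrib)
    have "2 * \<alpha> = real (card I) + d"
      by (simp add: \<alpha>_def)
    \<comment> \<open>This fixes the value of \<open>\<alpha>\<close>: the Jacobian and the
      homogeneity factor of \<open>h\<close> together have degree \<open>2 * \<alpha>\<close> in
      \<open>c\<close>, and \<open>c\<close> is \<open>s\<close> to the power
      \<open>- 1 / 2\<close>.\<close>
    have pw: "c ^ card I * c powr d = s powr (- \<alpha>)"
    proof -
      have "c ^ card I * c powr d = c powr (2 * \<alpha>)"
        using c \<open>2 * \<alpha> = real (card I) + d\<close> by (simp add: powr_add powr_realpow)
      also have "\<dots> = s powr (- \<alpha>)"
        by (simp add: cs powr_powr)
      finally show ?thesis .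
    qed
    have "(\<integral>\<^sup>+p. ennreal (?F p s) \<partial>?M)
        = (\<integral>\<^sup>+p. ennreal (c ^ card I * ?F (\<lambda>k\<in>I. c * p k) s) \<partial>?M)"
      using c I h f by (subst nn_integral_PiM_scale[OF I(1), of c])
        (auto simp: nn_integral_cmult[symmetric] ennreal_mult)
    also have "\<dots> = (\<integral>\<^sup>+p. ennreal (?G p s) \<partial>?M)"
    proof (intro nn_integral_cong arg_cong[where f = ennreal])
      fix p :: "'i \<Rightarrow> real"
      have "q p \<ge> 0"
        by (simp add: q_def sum_nonneg)
      then have "c ^ card I * ?F (\<lambda>k\<in>I. c * p k) s
          = (c ^ card I * c powr d) * (h p * exp (- q p / s) * (q p powr \<alpha> / s powr \<alpha>) * s powr (\<alpha> - 1) * f (a * q p))"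
        using True c by (simp add: qc hom powr_divide)
      also have "\<dots> = ?G p s"
        using True unfolding pw by (simp add: powr_diff powr_minus field_simps)
      finally show "c ^ card I * ?F (\<lambda>k\<in>I. c * p k) s = ?G p s" .
    qed
    finally show ?thesis .
  qed simp
  have 3: "(\<integral>\<^sup>+s. ennreal (?G p s) \<partial>lborel) = ennreal (Gamma \<alpha>) * ennreal (h p * f (a * q p))"
    if q: "q p > 0" for p
  proof -
    have "(\<integral>\<^sup>+s. ennreal (?G p s) \<partial>lborel)
      = (\<integral>\<^sup>+s. ennreal (indicator {0<..} s * (q p powr \<alpha> * s powr (- \<alpha> - 1) * exp (- q p / s)))
           * ennreal (h p * f (a * q p)) \<partial>lborel)"
      using h f by (intro nn_integral_cong) (simp add: ennreal_mult[symmetric] mult_ac)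
    then show ?thesis
      using nn_integral_inverse_Gamma[OF q \<alpha>] by (simp add: nn_integral_multc)
  qed
  have "(\<integral>\<^sup>+p. ennreal (h p * exp (- q p)) \<partial>?M) * J = (\<integral>\<^sup>+p. ennreal (h p * exp (- q p)) * J \<partial>?M)"
    by (simp add: nn_integral_multc)
  \<comment> \<open>The substitution degenerates only where \<open>q p = 0\<close>, on a null
    set.\<close>
  also have "\<dots> = (\<integral>\<^sup>+p. ennreal (a powr \<alpha>) * (\<integral>\<^sup>+s. ennreal (?F p s) \<partial>lborel) \<partial>?M)"
    using ae 1 by (intro nn_integral_cong_AE) auto
  also have "\<dots> = ennreal (a powr \<alpha>) * (\<integral>\<^sup>+p. \<integral>\<^sup>+s. ennreal (?F p s) \<partial>lborel \<partial>?M)"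
    by (intro nn_integral_cmult) measurable
  also have "(\<integral>\<^sup>+p. \<integral>\<^sup>+s. ennreal (?F p s) \<partial>lborel \<partial>?M) = (\<integral>\<^sup>+s. \<integral>\<^sup>+p. ennreal (?F p s) \<partial>?M \<partial>lborel)"
    by (intro Fubini'[symmetric]) measurable
  also have "\<dots> = (\<integral>\<^sup>+s. \<integral>\<^sup>+p. ennreal (?G p s) \<partial>?M \<partial>lborel)"
    by (simp only: 2)
  also have "\<dots> = (\<integral>\<^sup>+p. \<integral>\<^sup>+s. ennreal (?G p s) \<partial>lborel \<partial>?M)"
    by (intro Fubini') measurable
  also have "\<dots> = (\<integral>\<^sup>+p. ennreal (Gamma \<alpha>) * ennreal (h p * f (a * q p)) \<partial>?M)"
    using ae 3 by (intro nn_integral_cong_AE) auto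
  also have "\<dots> = ennreal (Gamma \<alpha>) * (\<integral>\<^sup>+p. ennreal (h p * f (a * q p)) \<partial>?M)"
    by (intro nn_integral_cmult) measurable
  finally show ?thesis
    using \<alpha> a by (simp add: J_def q_def ennreal_mult mult.assoc Gamma_real_pos)
qed

section \<open>Expansion of exponential integrals into moments\<close>

text \<open>Termwise integration of the exponential series, with majorant
  \<open>exp (norm z * \<bar>u p\<bar>) * w p\<close>, which is at most the sum of the two
  integrands assumed integrable. The field is kept general: a real \<open>z\<close> gives the
  Gaussian generating function, \<open>z = \<i>\<close> the Fourier integral.\<close>

lemma
  fixes u w :: "'a \<Rightarrow> real" and z :: "'b :: {real_normed_field, banach, second_countable_topology}"
  assumes [measurable]: "u \<in> borel_measurable M" "w \<in> borel_measurable M"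
    and w: "\<And>p. w p \<ge> 0" and z: "z \<noteq> 0"
    and pos: "integrable M (\<lambda>p. exp (norm z * u p) * w p)"
    and neg: "integrable M (\<lambda>p. exp (- norm z * u p) * w p)"
  shows integrable_exp_weight: "integrable M (\<lambda>p. exp (z * of_real (u p)) * of_real (w p))"
    and integrable_power_weight: "integrable M (\<lambda>p. u p ^ k * w p)"
    and summable_abs_moments: "summable (\<lambda>k. norm z ^ k / fact k * (\<integral>p. \<bar>u p\<bar> ^ k * w p \<partial>M))"
    and sums_moments: "(\<lambda>k. z ^ k / fact k * of_real (\<integral>p. u p ^ k * w p \<partial>M))
           sums (\<integral>p. exp (z * of_real (u p)) * of_real (w p) \<partial>M)"
proof -
  let ?D = "\<lambda>p. exp (norm z * \<bar>u p\<bar>) * w p"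
  have D: "integrable M ?D"
  proof (rule Bochner_Integration.integrable_bound[OF Bochner_Integration.integrable_add[OF pos neg]])
    have "?D p \<le> exp (norm z * u p) * w p + exp (- norm z * u p) * w p" for p
      using w[of p] by (cases "u p \<ge> 0") auto
    then show "AE p in M. norm (?D p) \<le> norm (exp (norm z * u p) * w p + exp (- norm z * u p) * w p)"
      using w by auto
  qed measurable
  have term_sums: "(\<lambda>k. norm z ^ k / fact k * (\<bar>u p\<bar> ^ k * w p)) sums ?D p" for p
    using sums_mult2[OF exp_converges[of "norm z * \<bar>u p\<bar>"], of "w p"]
    by (simp add: power_mult_distrib divide_inverse mult_ac)
  have int_abs: "integrable M (\<lambda>p. \<bar>u p\<bar> ^ k * w p)" for k
  proof (rule Bochner_Integration.integrable_bound[OF Bochner_Integration.integrable_mult_right[OF D]])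
    \<comment> \<open>One term of a series of nonnegative terms is at most its sum; dividing by the
      coefficient uses \<open>z \<noteq> 0\<close>.\<close>
    have "norm z ^ k / fact k * (\<bar>u p\<bar> ^ k * w p) \<le> ?D p" for p
      using sum_le_suminf[OF sums_summable[OF term_sums[of p]], of "{k}"] w[of p] sums_unique[OF term_sums[of p]]
      by simp
    then have "\<bar>u p\<bar> ^ k * w p \<le> fact k / norm z ^ k * ?D p" for p
      using z by (simp add: field_simps)
    then show "AE p in M. norm (\<bar>u p\<bar> ^ k * w p) \<le> norm (fact k / norm z ^ k * ?D p)"
      using w by (auto simp: abs_mult)
  qed measurable
  show int: "integrable M (\<lambda>p. u p ^ k * w p)" for k
    by (rule Bochner_Integration.integrable_bound[OF int_abs[of k]])
       (auto simp: abs_mult power_abs)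
  show sm: "summable (\<lambda>k. norm z ^ k / fact k * (\<integral>p. \<bar>u p\<bar> ^ k * w p \<partial>M))"
  proof (rule summableI_nonneg_bounded)
    show "0 \<le> norm z ^ k / fact k * (\<integral>p. \<bar>u p\<bar> ^ k * w p \<partial>M)" for k
      using w by (intro mult_nonneg_nonneg Bochner_Integration.integral_nonneg) auto
    fix n
    have "(\<Sum>k<n. norm z ^ k / fact k * (\<integral>p. \<bar>u p\<bar> ^ k * w p \<partial>M))
        = (\<integral>p. (\<Sum>k<n. norm z ^ k / fact k * (\<bar>u p\<bar> ^ k * w p)) \<partial>M)"
      using int_abs by (subst Bochner_Integration.integral_sum) auto
    also have "\<dots> \<le> (\<integral>p. ?D p \<partial>M)"
    proof (rule integral_mono[OF _ D])
      show "integrable M (\<lambda>p. \<Sum>k<n. norm z ^ k / fact k * (\<bar>u p\<bar> ^ k * w p))"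
        using int_abs by auto
      show "(\<Sum>k<n. norm z ^ k / fact k * (\<bar>u p\<bar> ^ k * w p)) \<le> ?D p" for p
        using sum_le_suminf[OF sums_summable[OF term_sums[of p]], of "{..<n}"] w[of p] sums_unique[OF term_sums[of p]]
        by simp
    qed
    finally show "(\<Sum>k<n. norm z ^ k / fact k * (\<integral>p. \<bar>u p\<bar> ^ k * w p \<partial>M)) \<le> (\<integral>p. ?D p \<partial>M)" .
  qed
  let ?f = "\<lambda>k p. z ^ k / fact k * of_real (u p ^ k * w p)"
  have f_norm: "norm (?f k p) = norm z ^ k / fact k * (\<bar>u p\<bar> ^ k * w p)" for k p
    using w[of p] by (simp add: norm_mult norm_divide norm_power abs_mult power_abs)
  have f_sums: "(\<lambda>k. ?f k p) sums (exp (z * of_real (u p)) * of_real (w p))" for p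
    using sums_mult2[OF exp_converges[of "z * of_real (u p)"], of "of_real (w p)"]
    by (simp add: power_mult_distrib divide_inverse scaleR_conv_of_real mult_ac)
  have f_int: "integrable M (?f k)" for k
    using int[of k] by (intro Bochner_Integration.integrable_mult_right integrable_of_real)
  have f_val: "(\<integral>p. ?f k p \<partial>M) = z ^ k / fact k * of_real (\<integral>p. u p ^ k * w p \<partial>M)" for k
    by (simp only: integral_mult_right_zero integral_bounded_linear[OF bounded_linear_of_real int])
  have ae: "AE p in M. summable (\<lambda>k. norm (?f k p))"
    unfolding f_norm using term_sums by (auto simp: sums_iff)
  have sf: "summable (\<lambda>k. \<integral>p. norm (?f k p) \<partial>M)"
    unfolding f_norm using sm int_abs by simp
  have "(\<Sum>k. ?f k p) = exp (z * of_real (u p)) * of_real (w p)" for p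
    using f_sums by (simp add: sums_iff)
  then show "integrable M (\<lambda>p. exp (z * of_real (u p)) * of_real (w p))"
      and "(\<lambda>k. z ^ k / fact k * of_real (\<integral>p. u p ^ k * w p \<partial>M))
           sums (\<integral>p. exp (z * of_real (u p)) * of_real (w p) \<partial>M)"
    using integrable_suminf[OF f_int ae sf] sums_integral[OF f_int ae sf] unfolding f_val by simp_all
qed

text \<open>The difference series vanishes identically, whereas a nonzero coefficient of positive
  index would make its zero at 0 isolated. Index 0 is settled by evaluating at 0.\<close>

lemma power_series_coeffs_unique:
  fixes a b :: "nat \<Rightarrow> 'a :: {real_normed_field, banach, perfect_space}"
  assumes a: "\<And>t. (\<lambda>n. a n * t ^ n) sums f t" and b: "\<And>t. (\<lambda>n. b n * t ^ n) sums f t"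
  shows "a = b"
proof
  fix m
  have 0: "(\<lambda>n. (a n - b n) * t ^ n) sums 0" for t
    using sums_diff[OF a[of t] b[of t]] by (simp add: algebra_simps)
  show "a m = b m"
  proof (rule ccontr)
    assume m: "a m \<noteq> b m"
    have "a 0 = b 0"
      using 0[of 0] powser_sums_zero_iff[of "\<lambda>n. a n - b n" 0] by simp
    with m have "m > 0"
      by (metis gr0I)
    with m obtain s where s: "0 < s" "\<And>z. z \<in> cball (0 :: 'a) s - {0} \<Longrightarrow> (0 :: 'a) \<noteq> 0"
      using powser_0_nonzero[where r = 1 and a = "\<lambda>n. a n - b n" and \<xi> = 0 and f = "\<lambda>_. 0" and m = m] 0 by (auto simp: algebra_simps)
    have "of_real s \<in> cball (0 :: 'a) s - {0}"
      using s(1) by simp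
    then show False
      using s(2) by blast
  qed
qed

text \<open>Comparison of the coefficients of \<open>t ^ (2 * n)\<close> in two expansions of the
  Gaussian generating function: by moments, and by the closed form
  \<open>exp (t\<^sup>2 * Y)\<close>.\<close>

lemma gaussian_even_moment_PiM:
  fixes y :: "'i \<Rightarrow> real"
  assumes I: "finite I"
  shows "has_bochner_integral (PiM I (\<lambda>_. lborel))
           (\<lambda>p. (\<Sum>k\<in>I. p k * y k) ^ (2 * n) * exp (- (\<Sum>k\<in>I. (p k)\<^sup>2)))
           (sqrt pi ^ card I * fact (2 * n) / fact n * ((\<Sum>k\<in>I. (y k)\<^sup>2) / 4) ^ n)"
proof -
  let ?M = "PiM I (\<lambda>_. lborel :: real measure)"
  define u where "u p = (\<Sum>k\<in>I. p k * y k)" for p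
  define w where "w p = exp (- (\<Sum>k\<in>I. (p k)\<^sup>2))" for p :: "'i \<Rightarrow> real"
  define Y where "Y = (\<Sum>k\<in>I. (y k)\<^sup>2) / 4"
  have [measurable]: "u \<in> borel_measurable ?M" "w \<in> borel_measurable ?M"
    unfolding u_def w_def by measurable
  have w: "w p \<ge> 0" for p
    by (simp add: w_def)
  have g: "has_bochner_integral ?M (\<lambda>p. exp (t * u p) * w p) (sqrt pi ^ card I * exp (t\<^sup>2 * Y))" for t
    using gaussian_exp_PiM[OF I, of t y] by (simp add: u_def w_def Y_def)
  have gi: "integrable ?M (\<lambda>p. exp (t * u p) * w p)" for t
    using g by (simp add: has_bochner_integral_iff)
  define a where "a k = (\<integral>p. u p ^ k * w p \<partial>?M) / fact k" for k
  \<comment> \<open>The coefficients of the closed form, padded with zeros at odd indices.\<close>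
  define b where "b k = (if even k then sqrt pi ^ card I * Y ^ (k div 2) / fact (k div 2) else 0)" for k
  have "(\<lambda>k. a k * t ^ k) sums (sqrt pi ^ card I * exp (t\<^sup>2 * Y))" for t
  \<comment> \<open>The moment expansion requires a nonzero parameter; at \<open>t = 0\<close> only
    the constant coefficient counts.\<close>
  proof (cases "t = 0")
    case True
    have "a 0 = sqrt pi ^ card I"
      using g[of 0] by (simp add: a_def has_bochner_integral_iff)
    then show ?thesis
      using True powser_sums_zero[of a] by simp
  next
    case False
    then show ?thesis
      using sums_moments[of u ?M w t, OF _ _ w False] gi[of "\<bar>t\<bar>"] gi[of "- \<bar>t\<bar>"] g[of t]
      by (simp add: a_def has_bochner_integral_iff mult_ac)
  qed
  moreover have "(\<lambda>k. b k * t ^ k) sums (sqrt pi ^ card I * exp (t\<^sup>2 * Y))" for t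
  proof -
    have "(\<lambda>k. b (2 * k) * t ^ (2 * k)) sums (sqrt pi ^ card I * exp (t\<^sup>2 * Y))"
      using sums_mult[OF exp_converges[of "t\<^sup>2 * Y"], of "sqrt pi ^ card I"]
      unfolding power_mult[of t 2] by (simp add: b_def power_mult_distrib divide_inverse mult_ac)
    then show ?thesis
      by (subst (asm) sums_mono_reindex[of "\<lambda>k. 2 * k" "\<lambda>k. b k * t ^ k"])
         (auto simp: strict_mono_def b_def elim!: evenE)
  qed
  ultimately have "a = b"
    by (rule power_series_coeffs_unique)
  then have "a (2 * n) = b (2 * n)"
    by simp
  then have "(\<integral>p. u p ^ (2 * n) * w p \<partial>?M) = sqrt pi ^ card I * fact (2 * n) / fact n * Y ^ n"
    by (simp add: a_def b_def field_simps)
  moreover have "integrable ?M (\<lambda>p. u p ^ (2 * n) * w p)"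
    using integrable_power_weight[of u ?M w "1 :: real"] w gi[of 1] gi[of "- 1"] by simp
  ultimately show ?thesis
    by (simp add: has_bochner_integral_iff u_def w_def Y_def)
qed

section \<open>Moments and Fourier integral of a radial weight\<close>

text \<open>The Gamma integral after \<open>r = a * t\<close>; it supplies the majorant for the
  radial integrals below.\<close>

lemma nn_integral_powr_exp:
  fixes a \<alpha> :: real
  assumes a: "a > 0" and \<alpha>: "\<alpha> > 0"
  shows "(\<integral>\<^sup>+r. ennreal (indicator {0<..} r * (r powr (\<alpha> - 1) * exp (- r / a))) \<partial>lborel)
           = ennreal (a powr \<alpha> * Gamma \<alpha>)"
proof -
  have "(\<integral>\<^sup>+r. ennreal (indicator {0<..} r * (r powr (\<alpha> - 1) * exp (- r / a))) \<partial>lborel)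
      = (\<integral>\<^sup>+t. ennreal (a powr \<alpha> * (indicator {0..} t * t powr (\<alpha> - 1) / exp t)) \<partial>lborel)"
    using a by (subst nn_integral_real_affine[of _ a 0])
      (auto simp: nn_integral_cmult[symmetric] ennreal_mult[symmetric] indicator_def
        zero_less_mult_iff powr_mult powr_diff exp_minus field_simps intro!: nn_integral_cong)
  also have "\<dots> = ennreal (a powr \<alpha> * Gamma \<alpha>)"
    using \<alpha> by (simp only: ennreal_mult' powr_ge_zero Gamma_conv_nn_integral_real) (rule nn_integral_cmult, measurable)
  finally show ?thesis .
qed

context
  fixes I :: "'i set" and y :: "'i \<Rightarrow> real" and f :: "real \<Rightarrow> real" and a C :: real
  assumes I: "finite I" "I \<noteq> {}" and a: "a > 0"
    and f_borel[measurable]: "f \<in> borel_measurable borel"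
    and f_nonneg: "\<And>r. f r \<ge> 0"
    and f_bound: "\<forall>r\<ge>0. f r \<le> C * exp (- r / a)"
begin

lemma radial_bound_nonneg: "C \<ge> 0"
  using f_bound[rule_format, of 0] f_nonneg[of 0] by simp

lemma integrable_powr_radial:
  assumes \<alpha>: "\<alpha> > 0"
  shows "integrable lborel (\<lambda>r. indicator {0<..} r * (r powr (\<alpha> - 1) * f r))"
proof -
  have "integrable lborel (\<lambda>r. indicator {0<..} r * (r powr (\<alpha> - 1) * exp (- r / a)))"
    using nn_integral_powr_exp[OF a \<alpha>] by (intro integrableI_nn_integral_finite[where x = "a powr \<alpha> * Gamma \<alpha>"]) auto
  then show ?thesis
  proof (rule Bochner_Integration.integrable_bound[OF Bochner_Integration.integrable_mult_right[where c = C]])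
    have "norm (indicator {0<..} r * (r powr (\<alpha> - 1) * f r)) \<le> norm (C * (indicator {0<..} r * (r powr (\<alpha> - 1) * exp (- r / a))))" for r
    proof (cases "r > 0")
      case True
      then have "r powr (\<alpha> - 1) * f r \<le> r powr (\<alpha> - 1) * (C * exp (- r / a))"
        using f_bound[rule_format, of r] by (intro mult_left_mono) auto
      then show ?thesis
        using True f_nonneg[of r] radial_bound_nonneg by (simp add: abs_mult mult_ac)
    qed simp
    then show "AE r in lborel. norm (indicator {0<..} r * (r powr (\<alpha> - 1) * f r))
        \<le> norm (C * (indicator {0<..} r * (r powr (\<alpha> - 1) * exp (- r / a))))"
      by simp
  qed measurable
qed

text \<open>The decay rate \<open>1 / a\<close> in \<open>f_bound\<close> is chosen so that the
  weight in \<open>p\<close> is dominated by \<open>C\<close> times the standard Gaussian, against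
  which every linear exponential is integrable.\<close>

lemma integrable_exp_linear_radial:
  "integrable (PiM I (\<lambda>_. lborel)) (\<lambda>p. exp (t * (\<Sum>k\<in>I. p k * y k)) * f (a * (\<Sum>k\<in>I. (p k)\<^sup>2)))"
proof (rule Bochner_Integration.integrable_bound[OF Bochner_Integration.integrable_mult_right[where c = C]])
  show "integrable (PiM I (\<lambda>_. lborel)) (\<lambda>p. exp (t * (\<Sum>k\<in>I. p k * y k)) * exp (- (\<Sum>k\<in>I. (p k)\<^sup>2)))"
    using gaussian_exp_PiM[OF I(1), of t y] by (simp add: has_bochner_integral_iff)
  have "norm (exp (t * (\<Sum>k\<in>I. p k * y k)) * f (a * (\<Sum>k\<in>I. (p k)\<^sup>2)))
      \<le> norm (C * (exp (t * (\<Sum>k\<in>I. p k * y k)) * exp (- (\<Sum>k\<in>I. (p k)\<^sup>2))))" for p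
  proof -
    have "f (a * (\<Sum>k\<in>I. (p k)\<^sup>2)) \<le> C * exp (- (\<Sum>k\<in>I. (p k)\<^sup>2))"
      using f_bound[rule_format, of "a * (\<Sum>k\<in>I. (p k)\<^sup>2)"] a by (simp add: sum_nonneg)
    then show ?thesis
      using f_nonneg[of "a * (\<Sum>k\<in>I. (p k)\<^sup>2)"] radial_bound_nonneg by (simp add: abs_mult mult_ac)
  qed
  then show "AE p in PiM I (\<lambda>_. lborel). norm (exp (t * (\<Sum>k\<in>I. p k * y k)) * f (a * (\<Sum>k\<in>I. (p k)\<^sup>2)))
      \<le> norm (C * (exp (t * (\<Sum>k\<in>I. p k * y k)) * exp (- (\<Sum>k\<in>I. (p k)\<^sup>2))))"
    by simp
qed measurable

lemma integral_odd_moment_radial: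
  assumes "odd n"
  shows "(\<integral>p. (\<Sum>k\<in>I. p k * y k) ^ n * f (a * (\<Sum>k\<in>I. (p k)\<^sup>2)) \<partial>PiM I (\<lambda>_. lborel)) = 0" (is "?m = 0")
proof -
  have "?m = (\<integral>p. - ((\<Sum>k\<in>I. p k * y k) ^ n * f (a * (\<Sum>k\<in>I. (p k)\<^sup>2))) \<partial>PiM I (\<lambda>_. lborel))"
    using assms by (subst integral_PiM_uminus[OF I(1)])
      (auto simp: sum_negf intro!: Bochner_Integration.integral_cong)
  then show ?thesis
    by simp
qed

text \<open>The radial identity with \<open>h\<close> the even power of the linear form, homogeneous
  of degree \<open>2 * n\<close> and nonnegative, solved for the moment. The Gaussian factor is
  already explicit, and domination makes all terms finite, so the \<open>ennreal\<close> equation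
  descends to the reals.\<close>

lemma integral_even_moment_radial:
  defines "\<alpha> n \<equiv> real (card I) / 2 + real n"
  shows "(\<integral>p. (\<Sum>k\<in>I. p k * y k) ^ (2 * n) * f (a * (\<Sum>k\<in>I. (p k)\<^sup>2)) \<partial>PiM I (\<lambda>_. lborel))
    = (pi / a) powr (card I / 2) * fact (2 * n) / (fact n * Gamma (\<alpha> n)) * ((\<Sum>k\<in>I. (y k)\<^sup>2) / (4 * a)) ^ n
      * (\<integral>r. indicator {0<..} r * (r powr (\<alpha> n - 1) * f r) \<partial>lborel)"
proof -
  let ?M = "PiM I (\<lambda>_. lborel :: real measure)"
  let ?u = "\<lambda>p. \<Sum>k\<in>I. p k * y k" and ?q = "\<lambda>p. \<Sum>k\<in>I. (p k)\<^sup>2"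
  define Y where "Y = (\<Sum>k\<in>I. (y k)\<^sup>2)"
  define G where "G = sqrt pi ^ card I * fact (2 * n) / fact n * (Y / 4) ^ n"
  define J where "J = (\<integral>r. indicator {0<..} r * (r powr (\<alpha> n - 1) * f r) \<partial>lborel)"
  define m where "m = (\<integral>p. ?u p ^ (2 * n) * f (a * ?q p) \<partial>?M)"
  have \<alpha>: "\<alpha> n > 0"
    using I by (simp add: \<alpha>_def card_gt_0_iff add_pos_nonneg)
  have \<alpha>': "(real (card I) + real (2 * n)) / 2 = \<alpha> n"
    by (simp add: \<alpha>_def)
  have "integrable ?M (\<lambda>p. ?u p ^ (2 * n) * f (a * ?q p))"
    using integrable_power_weight[of ?u ?M "\<lambda>p. f (a * ?q p)" "1 :: real"] f_nonneg
      integrable_exp_linear_radial[of 1] integrable_exp_linear_radial[of "- 1"] by simp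
  then have m: "(\<integral>\<^sup>+p. ennreal (?u p ^ (2 * n) * f (a * ?q p)) \<partial>?M) = ennreal m"
    unfolding m_def using f_nonneg by (intro nn_integral_eq_integral) auto
  have G: "(\<integral>\<^sup>+p. ennreal (?u p ^ (2 * n) * exp (- ?q p)) \<partial>?M) = ennreal G"
    using gaussian_even_moment_PiM[OF I(1), of y n] unfolding has_bochner_integral_iff
    by (subst nn_integral_eq_integral) (auto simp: G_def Y_def)
  have J: "(\<integral>\<^sup>+r. ennreal (indicator {0<..} r * (r powr (\<alpha> n - 1) * f r)) \<partial>lborel) = ennreal J"
    unfolding J_def using f_nonneg integrable_powr_radial[OF \<alpha>] by (intro nn_integral_eq_integral) auto
  have hom: "?u (\<lambda>k\<in>I. c * p k) ^ (2 * n) = c powr real (2 * n) * ?u p ^ (2 * n)" if "c > 0" for c p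
  proof -
    have "?u (\<lambda>k\<in>I. c * p k) = c * ?u p"
      by (simp add: sum_distrib_left mult_ac)
    then show ?thesis
      using that by (simp only: powr_realpow power_mult_distrib)
  qed
  have "ennreal G * ennreal J = ennreal (a powr \<alpha> n * Gamma (\<alpha> n)) * ennreal m"
    using nn_integral_homogeneous_radial[OF I a, of "real (2 * n)" "\<lambda>p. ?u p ^ (2 * n)" f] hom f_nonneg
    unfolding \<alpha>' m G J by simp
  moreover have "G \<ge> 0"
    by (simp add: G_def Y_def sum_nonneg)
  moreover have "J \<ge> 0" "m \<ge> 0"
    unfolding J_def m_def by (rule Bochner_Integration.integral_nonneg, simp add: f_nonneg)+
  ultimately have "G * J = a powr \<alpha> n * Gamma (\<alpha> n) * m"
    using Gamma_real_pos[OF \<alpha>] by (simp add: ennreal_mult[symmetric])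
  then have m_eq: "m = G / (a powr \<alpha> n * Gamma (\<alpha> n)) * J"
    using a Gamma_real_pos[OF \<alpha>] by (simp add: field_simps)
  \<comment> \<open>Of the power \<open>a powr \<alpha> n\<close>, the part of exponent
    \<open>card I / 2\<close> joins the powers of \<open>pi\<close>; the remaining
    \<open>a ^ n\<close> joins \<open>Y\<close>.\<close>
  have pi_eq: "(pi / a) powr (card I / 2) = sqrt pi ^ card I / a powr (card I / 2)"
  proof -
    have "sqrt pi ^ card I = (pi powr (1 / 2)) powr real (card I)"
      by (simp add: powr_half_sqrt powr_realpow)
    also have "\<dots> = pi powr (card I / 2)"
      by (simp only: powr_powr) simp
    finally show ?thesis
      using a by (simp add: powr_divide)
  qed
  have a_eq: "a powr \<alpha> n = a powr (card I / 2) * a ^ n"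
    using a by (simp add: \<alpha>_def powr_add powr_realpow)
  have "m = (pi / a) powr (card I / 2) * fact (2 * n) / (fact n * Gamma (\<alpha> n)) * (Y / (4 * a)) ^ n * J"
    unfolding m_eq pi_eq a_eq G_def by (simp add: power_divide power_mult_distrib mult_ac)
  then show ?thesis
    unfolding m_def J_def Y_def .
qed

text \<open>The moment expansion at \<open>z = \<i>\<close>: odd terms vanish,
  \<open>\<i> ^ (2 * n)\<close> gives the sign, and \<open>fact (2 * n)\<close> cancels against the
  even moment. Here \<open>\<nu>\<close> is \<open>\<alpha> 0 - 1\<close> of the even moments. The
  last conclusion is the absolute convergence needed to resum under the radial integral.\<close>

lemma radial_fourier_series:
  fixes s :: real
  defines "s \<equiv> (\<Sum>k\<in>I. (y k)\<^sup>2) / (4 * a)" and "\<nu> \<equiv> real (card I) / 2 - 1"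
  defines "J \<equiv> \<lambda>n. (\<integral>r. indicator {0<..} r * (r powr (\<nu> + real n) * f r) \<partial>lborel)"
  shows "integrable (PiM I (\<lambda>_. lborel))
           (\<lambda>p. exp (\<i> * of_real (\<Sum>k\<in>I. p k * y k)) * complex_of_real (f (a * (\<Sum>k\<in>I. (p k)\<^sup>2))))" (is ?int)
    and "(\<lambda>n. complex_of_real ((pi / a) powr (card I / 2) * ((- s) ^ n / (fact n * Gamma (\<nu> + real n + 1)) * J n)))
           sums (\<integral>p. exp (\<i> * of_real (\<Sum>k\<in>I. p k * y k)) * complex_of_real (f (a * (\<Sum>k\<in>I. (p k)\<^sup>2)))
             \<partial>PiM I (\<lambda>_. lborel))" (is ?sums)
    and "summable (\<lambda>n. s ^ n / (fact n * Gamma (\<nu> + real n + 1)) * J n)" (is ?summable)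
proof -
  let ?M = "PiM I (\<lambda>_. lborel :: real measure)"
  let ?u = "\<lambda>p. \<Sum>k\<in>I. p k * y k" and ?w = "\<lambda>p. f (a * (\<Sum>k\<in>I. (p k)\<^sup>2))"
  have u[measurable]: "?u \<in> borel_measurable ?M" and w[measurable]: "?w \<in> borel_measurable ?M"
    by measurable
  have e: "integrable ?M (\<lambda>p. exp (norm \<i> * ?u p) * ?w p)" "integrable ?M (\<lambda>p. exp (- norm \<i> * ?u p) * ?w p)"
    using integrable_exp_linear_radial[of 1] integrable_exp_linear_radial[of "- 1"] by simp_all
  note gen = u w f_nonneg complex_i_not_zero e
  show ?int
    by (rule integrable_exp_weight[OF gen])
  have even: "(\<integral>p. ?u p ^ (2 * n) * ?w p \<partial>?M)
    = (pi / a) powr (card I / 2) * fact (2 * n) / (fact n * Gamma (\<nu> + real n + 1)) * s ^ n * J n" for n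
    using integral_even_moment_radial[of n] by (simp add: s_def \<nu>_def J_def algebra_simps)
  have odd: "(\<integral>p. ?u p ^ n * ?w p \<partial>?M) = 0" if "n \<notin> range (\<lambda>k. 2 * k)" for n
    using that by (intro integral_odd_moment_radial) (auto elim!: evenE)
  have "(\<lambda>n. \<i> ^ (2 * n) / fact (2 * n) * of_real (\<integral>p. ?u p ^ (2 * n) * ?w p \<partial>?M))
      sums (\<integral>p. exp (\<i> * of_real (?u p)) * of_real (?w p) \<partial>?M)"
    using sums_moments[OF gen]
    by (subst sums_mono_reindex[of "\<lambda>n. 2 * n" "\<lambda>k. \<i> ^ k / fact k * of_real (\<integral>p. ?u p ^ k * ?w p \<partial>?M)"])
       (simp_all add: strict_mono_def odd del: of_real_sum)
  moreover have "\<i> ^ (2 * n) / fact (2 * n) * of_real (\<integral>p. ?u p ^ (2 * n) * ?w p \<partial>?M)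
      = complex_of_real ((pi / a) powr (card I / 2) * ((- s) ^ n / (fact n * Gamma (\<nu> + real n + 1)) * J n))" for n
    unfolding even power_mult[of \<i>] by (simp add: power_minus[of s] mult_ac)
  ultimately show ?sums
    by (simp only:)
  \<comment> \<open>The even-indexed part of the convergent series of absolute moments; even powers
    need no absolute value.\<close>
  have "summable ((\<lambda>k. norm \<i> ^ k / fact k * (\<integral>p. \<bar>?u p\<bar> ^ k * ?w p \<partial>?M)) \<circ> (\<lambda>n. 2 * n))"
    using f_nonneg by (intro summable_reindex summable_abs_moments[OF gen])
      (auto intro!: inj_onI mult_nonneg_nonneg Bochner_Integration.integral_nonneg)
  then have "summable (\<lambda>n. 1 / fact (2 * n) * (\<integral>p. ?u p ^ (2 * n) * ?w p \<partial>?M))"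
    by (simp add: o_def power_even_abs)
  then have "summable (\<lambda>n. (pi / a) powr (card I / 2) * (s ^ n / (fact n * Gamma (\<nu> + real n + 1)) * J n))"
    unfolding even by (simp add: mult_ac)
  then show ?summable
    using a by (subst (asm) summable_cmult_iff) auto
qed

end

section \<open>The power series of the Bessel factor\<close>

text \<open>The quotient is the Pochhammer product, whose factors are all at least 1.\<close>

lemma Gamma_add_nat_ge:
  fixes x :: real
  assumes "x \<ge> 1"
  shows "Gamma x \<le> Gamma (x + real n)"
proof -
  have "1 \<le> pochhammer x n"
    using assms by (induction n) (auto simp: pochhammer_Suc intro: order_trans[OF _ mult_mono[of 1 _ 1]])
  moreover have "x \<notin> \<int>\<^sub>\<le>\<^sub>0"
    using assms by (auto elim!: nonpos_Ints_cases)
  ultimately show ?thesis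
    using assms pochhammer_Gamma[of x n] Gamma_real_pos[of x] by (simp add: le_divide_eq)
qed

text \<open>Replacing each \<open>Gamma (\<nu> + real n + 1)\<close> by the smaller
  \<open>Gamma (\<nu> + 1)\<close> leaves an exponential series in \<open>s * r\<close>, which gives
  absolute convergence. The sum is then \<open>r powr \<nu>\<close> times the series in
  \<open>bessel_J\<close>.\<close>

lemma
  fixes \<nu> s r :: real
  assumes \<nu>: "\<nu> \<ge> 0" and s: "s \<ge> 0" and r: "r > 0"
  shows summable_bessel_factor:
      "summable (\<lambda>n. s ^ n / (fact n * Gamma (\<nu> + real n + 1)) * r powr (\<nu> + real n))" (is ?summable)
    and sums_bessel_factor:
      "(\<lambda>n. (- s) ^ n / (fact n * Gamma (\<nu> + real n + 1)) * r powr (\<nu> + real n)) sums bessel_factor \<nu> s r" (is ?sums)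
proof -
  have pw: "r powr (\<nu> + real n) = r powr \<nu> * r ^ n" for n
    using r by (simp add: powr_add powr_realpow)
  have G: "Gamma (\<nu> + 1) \<le> Gamma (\<nu> + real n + 1)" "0 < Gamma (\<nu> + 1)" for n
    using Gamma_add_nat_ge[of "\<nu> + 1" n] \<nu> by (auto simp: add_ac Gamma_real_pos)
  show ?summable
  proof (rule summable_comparison_test')
    show "summable (\<lambda>n. r powr \<nu> / Gamma (\<nu> + 1) * (inverse (fact n) * (s * r) ^ n))"
      by (intro summable_mult summable_exp)
    have "s ^ n / (fact n * Gamma (\<nu> + real n + 1)) \<le> s ^ n / (fact n * Gamma (\<nu> + 1))" for n
      using s G(1)[of n] G(2) by (intro divide_left_mono mult_left_mono mult_pos_pos) auto
    then have "s ^ n / (fact n * Gamma (\<nu> + real n + 1)) * (r powr \<nu> * r ^ n)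
        \<le> s ^ n / (fact n * Gamma (\<nu> + 1)) * (r powr \<nu> * r ^ n)" for n
      using r by (intro mult_right_mono) auto
    moreover have "0 \<le> s ^ n / (fact n * Gamma (\<nu> + real n + 1)) * (r powr \<nu> * r ^ n)" for n
      using s r G(1)[of n] G(2) by auto
    ultimately show "norm (s ^ n / (fact n * Gamma (\<nu> + real n + 1)) * r powr (\<nu> + real n))
        \<le> r powr \<nu> / Gamma (\<nu> + 1) * (inverse (fact n) * (s * r) ^ n)" if "n \<ge> 0" for n
      unfolding pw by (simp only: real_norm_def abs_of_nonneg) (simp add: power_mult_distrib field_simps)
  qed
  let ?t = "\<lambda>n. (- s) ^ n / (fact n * Gamma (\<nu> + real n + 1)) * r powr (\<nu> + real n)"
  have "norm (?t n) = s ^ n / (fact n * Gamma (\<nu> + real n + 1)) * r powr (\<nu> + real n)" for n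
    using s G(1)[of n] G(2) by (simp add: abs_mult power_abs)
  then have sm: "summable ?t"
    by (intro summable_norm_cancel[OF iffD2[OF _ \<open>?summable\<close>]] arg_cong[where f = summable] ext)
  show ?sums
  proof (cases "s = 0")
    case True
    \<comment> \<open>With \<open>0 ^ 0 = 1\<close> only the term at \<open>n = 0\<close> survives,
      which is the value \<open>bessel_factor\<close> takes at \<open>s = 0\<close>.\<close>
    have "?t sums ?t 0"
      using sums_finite[of "{0}" ?t] True by simp
    then show ?thesis
      using True by (simp add: bessel_factor_def)
  next
    case False
    with s have s: "s > 0"
      by simp
    let ?b = "\<lambda>n. (- 1) ^ n / (fact n * Gamma (\<nu> + real n + 1)) * (2 * sqrt (s * r) / 2) ^ (2 * n)"
    have tb: "?t n = r powr \<nu> * ?b n" for n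
      using s r by (simp add: pw power_mult power_mult_distrib power_minus[of s])
    have "?b sums (\<Sum>n. ?b n)"
      using sm r unfolding tb by (subst (asm) summable_cmult_iff) (simp_all add: summable_sums)
    then have "?t sums (r powr \<nu> * (\<Sum>n. ?b n))"
      unfolding tb by (rule sums_mult)
    \<comment> \<open>The powers of \<open>s\<close> cancel between the two prefactors. Since
      \<open>s * r > 0\<close>, the two branches agree at \<open>\<nu> = 0\<close>.\<close>
    moreover have "(r / s) powr (\<nu> / 2) * (if \<nu> = 0 then 1 else (2 * sqrt (s * r) / 2) powr \<nu>) = r powr \<nu>"
    proof -
      have "(r / s) powr (\<nu> / 2) * (s * r) powr (\<nu> / 2) = r powr (\<nu> / 2) * r powr (\<nu> / 2)"
        using s r by (simp add: powr_divide powr_mult)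
      also have "\<dots> = r powr \<nu>"
        by (simp flip: powr_add)
      finally show ?thesis
        using s r by (simp add: powr_half_sqrt[symmetric] powr_powr)
    qed
    ultimately show ?thesis
      using s by (simp add: bessel_factor_def bessel_J_def mult.assoc[symmetric])
  qed
qed

section \<open>The Fourier integral as a Bessel integral\<close>

context
  fixes I :: "'i set" and y :: "'i \<Rightarrow> real" and f :: "real \<Rightarrow> real" and a C :: real
  assumes I: "finite I" "card I \<ge> 2" and a: "a > 0"
    and f_borel[measurable]: "f \<in> borel_measurable borel"
    and f_nonneg: "\<And>r. f r \<ge> 0"
    and f_bound: "\<forall>r\<ge>0. f r \<le> C * exp (- r / a)"
begin

text \<open>Both sides are sums of one series: the momentum side by the moment expansion, the radial
  side by integrating the Bessel series term by term. The bound \<open>card I \<ge> 2\<close> gives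
  \<open>\<nu> \<ge> 0\<close>, as the Bessel series lemma requires.\<close>

lemma
  fixes s \<nu> :: real
  defines "s \<equiv> (\<Sum>k\<in>I. (y k)\<^sup>2) / (4 * a)" and "\<nu> \<equiv> real (card I) / 2 - 1"
  shows set_integrable_bessel_factor: "set_integrable lborel {0<..} (\<lambda>r. bessel_factor \<nu> s r * f r)" (is ?int)
    and radial_fourier_bessel:
      "(\<integral>p. exp (\<i> * of_real (\<Sum>k\<in>I. p k * y k)) * complex_of_real (f (a * (\<Sum>k\<in>I. (p k)\<^sup>2))) \<partial>PiM I (\<lambda>_. lborel))
        = complex_of_real ((pi / a) powr (card I / 2) * (LINT r:{0<..}|lborel. bessel_factor \<nu> s r * f r))" (is ?val)
proof -
  have I': "I \<noteq> {}"
    using I by auto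
  have \<nu>: "\<nu> \<ge> 0" and s: "s \<ge> 0"
    using I a by (auto simp: \<nu>_def s_def sum_nonneg)
  have G: "Gamma (\<nu> + real n + 1) > 0" for n
    using \<nu> by (intro Gamma_real_pos) auto
  define c where "c n = s ^ n / (fact n * Gamma (\<nu> + real n + 1))" for n
  define J where "J n = (\<integral>r. indicator {0<..} r * (r powr (\<nu> + real n) * f r) \<partial>lborel)" for n
  let ?F = "\<lambda>n r. (- 1) ^ n * c n * (indicator {0<..} r * (r powr (\<nu> + real n) * f r))"
  have c: "c n \<ge> 0" for n
    using s G[of n] by (simp add: c_def)
  have c': "(- s) ^ n / (fact n * Gamma (\<nu> + real n + 1)) = (- 1) ^ n * c n" for n
    by (simp add: c_def power_minus[of s])
  note series = radial_fourier_series[OF I(1) I' a f_borel f_nonneg f_bound, of y, folded s_def \<nu>_def, folded J_def, unfolded c', folded c_def]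
  have int: "integrable lborel (\<lambda>r. indicator {0<..} r * (r powr (\<nu> + real n) * f r))" for n
    using integrable_powr_radial[OF I(1) I' a f_borel f_nonneg f_bound, of "\<nu> + real n + 1"] \<nu> by simp
  then have F_int: "integrable lborel (?F n)" for n
    by (rule Bochner_Integration.integrable_mult_right)
  have F_norm: "norm (?F n r) = c n * (indicator {0<..} r * (r powr (\<nu> + real n) * f r))" for n r
    using c[of n] f_nonneg[of r] by (simp add: abs_mult)
  have F_sums: "(\<lambda>n. ?F n r) sums (indicator {0<..} r *\<^sub>R (bessel_factor \<nu> s r * f r))" for r
    using sums_mult2[OF sums_bessel_factor[OF \<nu> s, of r, unfolded c'], of "f r"]
    by (cases "r > 0") (simp_all add: mult.assoc)
  have ae: "AE r in lborel. summable (\<lambda>n. norm (?F n r))"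
  proof (intro AE_I2)
    fix r
    show "summable (\<lambda>n. norm (?F n r))"
      unfolding F_norm using summable_mult2[OF summable_bessel_factor[OF \<nu> s, of r, folded c_def], of "f r"]
      by (cases "r > 0") (simp_all add: mult.assoc)
  qed
  \<comment> \<open>Taking norms only removes the sign, so the integrals are
    \<open>c n * J n\<close>, summable by the third part of \<open>series\<close>.\<close>
  have sm: "summable (\<lambda>n. \<integral>r. norm (?F n r) \<partial>lborel)"
    unfolding F_norm using series(3) int by (simp add: J_def)
  have S: "(\<Sum>n. ?F n r) = indicator {0<..} r *\<^sub>R (bessel_factor \<nu> s r * f r)" for r
    using F_sums by (simp add: sums_iff)
  show ?int
    using integrable_suminf[OF F_int ae sm] unfolding S set_integrable_def .
  have "(\<lambda>n. (- 1) ^ n * c n * J n) sums (LINT r:{0<..}|lborel. bessel_factor \<nu> s r * f r)"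
    using sums_integral[OF F_int ae sm] int unfolding S set_lebesgue_integral_def by (simp add: J_def)
  from sums_of_real[OF sums_mult[OF this], of "(pi / a) powr (card I / 2)", where 'a = complex] show ?val
    by (rule sums_unique2[OF series(2)])
qed

end

section \<open>The kernel in the physical parameters\<close>

text \<open>Integrability is claimed together with the formula because the Bochner integral of a
  non-integrable function is 0 by convention, so the equation alone would not show that the
  integrals exist.\<close>

theorem mainTheorem4:
  fixes N :: nat and m \<epsilon> E :: real and V :: "real \<Rightarrow> real" and x :: "nat \<Rightarrow> real"
  assumes "N \<ge> 2" and "m > 0" and "\<epsilon> > 0" and "x 0 = x N"
  shows "integrable (momentum_space N) (K_integrand N m \<epsilon> E V x) \<and>
         set_integrable lborel {0<..} (radial_integrand N m \<epsilon> E V x) \<and>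
         K N m \<epsilon> E V x =
           complex_of_real
             ((m * real N * \<epsilon> / (2 * pi)) powr (real N / 2) * (1 / sqrt (2 * pi * \<epsilon>\<^sup>2)) *
              (LINT r:{0<..}|lborel. radial_integrand N m \<epsilon> E V x r))"
proof -
  define a where "a = 1 / (2 * m * real N * \<epsilon>)"
  define c where "c = S1 N \<epsilon> V x - E / \<epsilon>"
  define f where "f r = exp (- 1 / 2 * (r + c)\<^sup>2)" for r
  define y where "y k = x (k - 1) - x k" for k
  define B where "B = 1 / (2 * complex_of_real pi) ^ N / complex_of_real (sqrt (2 * pi * \<epsilon>\<^sup>2))"
  have N: "finite {1..N}" "card {1..N} \<ge> 2" "{1..N} \<noteq> {}"
    using assms by auto
  have a: "a > 0"
    using assms by (simp add: a_def)
  have f: "f \<in> borel_measurable borel" "\<And>r. f r \<ge> 0"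
    unfolding f_def by auto
  have bound: "\<forall>r\<ge>0. f r \<le> exp (1 / (2 * a\<^sup>2) - c / a) * exp (- r / a)"
  proof (intro allI impI)
    fix r :: real
    \<comment> \<open>the Gaussian in \<open>r\<close> is dominated by \<open>exp (- r / a)\<close>: complete the square\<close>
    have "0 \<le> (r + c - 1 / a)\<^sup>2 / 2"
      by simp
    also have "\<dots> = (r + c)\<^sup>2 / 2 - (r + c) / a + 1 / (2 * a\<^sup>2)"
      by (simp add: power2_diff add_divide_distrib diff_divide_distrib power_divide)
    finally have "- 1 / 2 * (r + c)\<^sup>2 \<le> 1 / (2 * a\<^sup>2) - c / a - r / a"
      unfolding add_divide_distrib by linarith
    then show "f r \<le> exp (1 / (2 * a\<^sup>2) - c / a) * exp (- r / a)"
      by (simp add: f_def flip: exp_add)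
  qed
  \<comment> \<open>Both sides carry the factor \<open>m * real N * \<epsilon> / 2\<close>: on the
    left one of the two powers of \<open>real N * \<epsilon>\<close> from the squared velocity
    cancels, on the right it is \<open>1 / (4 * a)\<close>.\<close>
  have s: "S0 N m \<epsilon> x = (\<Sum>k=1..N. (y k)\<^sup>2) / (4 * a)"
  proof -
    have "S0 N m \<epsilon> x = (\<Sum>k=1..N. (y k)\<^sup>2 * (m * real N * \<epsilon> / 2))"
      using assms unfolding S0_def sum_distrib_left
      by (intro sum.cong refl) (simp add: y_def power_mult_distrib power2_eq_square)
    also have "\<dots> = (\<Sum>k=1..N. (y k)\<^sup>2) * (m * real N * \<epsilon> / 2)"
      by (rule sum_distrib_right[symmetric])
    finally show ?thesis
      by (simp add: a_def mult_ac)
  qed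
  have \<nu>: "(real N - 2) / 2 = real (card {1..N}) / 2 - 1"
    by (simp add: diff_divide_distrib)
  have R: "radial_integrand N m \<epsilon> E V x
      = (\<lambda>r. bessel_factor (real (card {1..N}) / 2 - 1) ((\<Sum>k=1..N. (y k)\<^sup>2) / (4 * a)) r * f r)"
    unfolding radial_integrand_def s \<nu> f_def c_def by (simp add: algebra_simps)
  have Kint: "K_integrand N m \<epsilon> E V x
      = (\<lambda>p. B * (exp (\<i> * of_real (\<Sum>k=1..N. p k * y k)) * complex_of_real (f (a * (\<Sum>k=1..N. (p k)\<^sup>2)))))"
    unfolding K_integrand_def B_def f_def a_def c_def y_def by (simp add: add_diff_eq)
  have const: "B * complex_of_real ((pi / a) powr (card {1..N} / 2))
      = complex_of_real ((m * real N * \<epsilon> / (2 * pi)) powr (real N / 2) * (1 / sqrt (2 * pi * \<epsilon>\<^sup>2)))"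
  proof -
    let ?X = "m * real N * \<epsilon> / (2 * pi)"
    \<comment> \<open>Splitting off \<open>(2 * pi) powr 2\<close> leaves, after the power
      \<open>real N / 2\<close>, exactly the \<open>(2 * pi) ^ N\<close> that cancels the
      normalisation in \<open>B\<close>.\<close>
    have "pi / a = (2 * pi) powr 2 * ?X"
      by (simp add: a_def powr_numeral power2_eq_square)
    then have "(pi / a) powr (real N / 2) = (2 * pi) powr real N * ?X powr (real N / 2)"
      using assms by (simp only: powr_mult powr_powr) simp
    also have "(2 * pi) powr real N = (2 * pi) ^ N"
      by (simp add: powr_realpow)
    finally show ?thesis
      by (simp add: B_def)
  qed
  have "K N m \<epsilon> E V x = B * complex_of_real ((pi / a) powr (card {1..N} / 2)
      * (LINT r:{0<..}|lborel. radial_integrand N m \<epsilon> E V x r))"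
    unfolding K_def R Kint integral_mult_right_zero
    by (simp only: radial_fourier_bessel[OF N(1,2) a f bound])
  moreover have "integrable (momentum_space N) (K_integrand N m \<epsilon> E V x)"
    unfolding Kint by (intro Bochner_Integration.integrable_mult_right radial_fourier_series(1)[OF N(1,3) a f bound])
  moreover have "set_integrable lborel {0<..} (radial_integrand N m \<epsilon> E V x)"
    unfolding R by (rule set_integrable_bessel_factor[OF N(1,2) a f bound])
  ultimately show ?thesis
    using const by (simp add: mult.assoc[symmetric])
qed

end
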